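(* Let $X=\bigsqcup_{n\in\mathbb N}X_n$ and $Y=\bigsqcup_{n\in\mathbb N}Y_n$ be coarse disjoint unions of expander graphs, and let $f\colon X\to Y$ be a coarse equivalence. The following are equivalent. (1) The map $f$ is close to a bijective coarse equivalence $X\to Y$. (2) There are cofinite subsets $N,M$ of $\mathbb N$ and a bijection $i\colon N\to M$ such that \[\sum_{n\in\mathbb N\setminus N}|X_n|=\sum_{n\in\mathbb N\setminus M}|Y_n|\] and, for all $n\in N$, \[|X_n|=|Y_{i(n)}|\quad\text{and}\quad f(X_n)\subseteq Y_{i(n)}.\]
   Context: Two maps $f,g\colon X\to(Y,d_Y)$ from a set into a metric space are close if $\sup_{x\in X}d_Y(f(x),g(x))<\infty$. A map $f\colon(X,d_X)\to(Y,d_Y)$ between metric spaces is coarse if for all $r>0$ there is $s>0$ such that $d_X(x,z)<r$ implies $d_Y(f(x),f(z))<s$. A coarse map $f\colon X\to Y$ is a coarse equivalence if there is a coarse map $g\colon Y\to X$ such that $g\circ f$ and $f\circ g$ are close to the respective identity maps. A bijective coarse equivalence is a coarse equivalence that is also a bijection. Graphs are simple, unweighted and undirected, and are identified with their vertex sets equipped with the shortest path metric. For a subset $A$ of a graph $X$, $\partial(A)=\{x\in X\setminus A\mid d_X(x,A)\le 1\}$. For $k\in\mathbb N$ and $h>0$, a finite graph $X$ is a $(k,h)$-expander graph if each vertex is incident to at most $k$ edges and $|\partial(A)|\ge h\big(1-\frac{|A|}{|X|}\big)|A|$ for all $A\subseteq X$. A sequence $(X_n)_n$ of finite graphs is a sequence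 of expander graphs if there are $k\in\mathbb N$ and $h>0$ such that each $X_n$ is a $(k,h)$-expander graph, and $|X_n|\to\infty$ as $n\to\infty$. A coarse disjoint union of a sequence $(X_n)_n$ of finite metric spaces is the disjoint union $\bigsqcup_nX_n$ equipped with any metric $d$ that restricts to the given metric on each $X_n$ and satisfies $d(X_n,X_m)\to\infty$ as $(n,m)\to\infty$ in $\{(n,m)\in\mathbb N^2\mid n\ne m\}$ (i.e., for each $R$, $d(X_n,X_m)>R$ for all but finitely many pairs $n\neq m$). A coarse disjoint union of expander graphs is a coarse disjoint union of a sequence of expander graphs. *)

theory Defs
  imports
    "HOL-Analysis.Abstract_Metric_Spaces"
    "Graph_Theory.Pair_Digraph"
    "Graph_Theory.Shortest_Path"
begin

definition close_maps ::
  "'a set \<Rightarrow> ('b \<Rightarrow> 'b \<Rightarrow> real) \<Rightarrow> ('a \<Rightarrow> 'b) \<Rightarrow> ('a \<Rightarrow> 'b) \<Rightarrow> bool" where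
  "close_maps X dY f g \<longleftrightarrow> (SUP x\<in>X. ereal (dY (f x) (g x))) < \<infinity>"

definition coarse_map ::
  "'a set \<Rightarrow> ('a \<Rightarrow> 'a \<Rightarrow> real) \<Rightarrow> 'b set \<Rightarrow> ('b \<Rightarrow> 'b \<Rightarrow> real) \<Rightarrow> ('a \<Rightarrow> 'b) \<Rightarrow> bool" where
  "coarse_map X dX Y dY f \<longleftrightarrow>
     f ` X \<subseteq> Y \<and>
     (\<forall>r>0. \<exists>s>0. \<forall>x\<in>X. \<forall>z\<in>X. dX x z < r \<longrightarrow> dY (f x) (f z) < s)"

definition coarse_equivalence ::
  "'a set \<Rightarrow> ('a \<Rightarrow> 'a \<Rightarrow> real) \<Rightarrow> 'b set \<Rightarrow> ('b \<Rightarrow> 'b \<Rightarrow> real) \<Rightarrow> ('a \<Rightarrow> 'b) \<Rightarrow> bool" where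
  "coarse_equivalence X dX Y dY f \<longleftrightarrow>
     coarse_map X dX Y dY f \<and>
     (\<exists>g. coarse_map Y dY X dX g \<and> close_maps X dX (g \<circ> f) id \<and> close_maps Y dY (f \<circ> g) id)"

definition bijective_coarse_equivalence ::
  "'a set \<Rightarrow> ('a \<Rightarrow> 'a \<Rightarrow> real) \<Rightarrow> 'b set \<Rightarrow> ('b \<Rightarrow> 'b \<Rightarrow> real) \<Rightarrow> ('a \<Rightarrow> 'b) \<Rightarrow> bool" where
  "bijective_coarse_equivalence X dX Y dY f \<longleftrightarrow>
     coarse_equivalence X dX Y dY f \<and> bij_betw f X Y"

text \<open>
  A finite simple undirected graph is a \<open>pair_graph\<close>: an edge between \<open>u\<close> and \<open>v\<close> is
  represented by the two arcs \<open>(u, v)\<close> and \<open>(v, u)\<close>, so the number of edges incident to a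
  vertex is its out-degree. The shortest path distance is extended-real valued, being
  \<open>\<infinity>\<close> between different connected components.
\<close>

definition graph_dist :: "'a pair_pre_digraph \<Rightarrow> 'a \<Rightarrow> 'a \<Rightarrow> ereal" where
  "graph_dist G = wf_digraph.\<mu> (with_proj G) (\<lambda>_. 1)"

definition boundary :: "'a pair_pre_digraph \<Rightarrow> 'a set \<Rightarrow> 'a set" where
  "boundary G A = {x \<in> pverts G - A. (INF a\<in>A. graph_dist G x a) \<le> 1}"

definition expander_graph :: "nat \<Rightarrow> real \<Rightarrow> 'a pair_pre_digraph \<Rightarrow> bool" where
  "expander_graph k h G \<longleftrightarrow>
     pair_graph G \<and>
     (\<forall>v\<in>pverts G. out_degree (with_proj G) v \<le> k) \<and>
     (\<forall>A\<subseteq>pverts G.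
        real (card (boundary G A)) \<ge> h * (1 - real (card A) / real (card (pverts G))) * real (card A))"

definition expander_sequence :: "(nat \<Rightarrow> 'a pair_pre_digraph) \<Rightarrow> bool" where
  "expander_sequence G \<longleftrightarrow>
     (\<exists>k. \<exists>h>0. \<forall>n. expander_graph k h (G n)) \<and>
     filterlim (\<lambda>n. card (pverts (G n))) at_top sequentially"

definition disjoint_union :: "(nat \<Rightarrow> 'a set) \<Rightarrow> (nat \<times> 'a) set" where
  "disjoint_union V = (SIGMA n:UNIV. V n)"

definition component :: "(nat \<Rightarrow> 'a set) \<Rightarrow> nat \<Rightarrow> (nat \<times> 'a) set" where
  "component V n = {n} \<times> V n"

definition set_distance :: "('a \<Rightarrow> 'a \<Rightarrow> real) \<Rightarrow> 'a set \<Rightarrow> 'a set \<Rightarrow> ereal" where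
  "set_distance d A B = (INF a\<in>A. INF b\<in>B. ereal (d a b))"

text \<open>
  The given distances \<open>\<delta> n\<close> may be extended-real valued, so that \<^const>\<open>graph_dist\<close> can be used
  for them; as \<open>d\<close> is real valued, restricting to \<open>\<delta> n\<close> forces them to be finite on \<open>V n\<close>.
\<close>

definition coarse_disjoint_union ::
  "(nat \<Rightarrow> 'a set) \<Rightarrow> (nat \<Rightarrow> 'a \<Rightarrow> 'a \<Rightarrow> ereal) \<Rightarrow> (nat \<times> 'a \<Rightarrow> nat \<times> 'a \<Rightarrow> real) \<Rightarrow> bool" where
  "coarse_disjoint_union V \<delta> d \<longleftrightarrow>
     (\<forall>n. finite (V n)) \<and>
     Metric_space (disjoint_union V) d \<and>
     (\<forall>n. \<forall>x\<in>V n. \<forall>y\<in>V n. ereal (d (n, x) (n, y)) = \<delta> n x y) \<and>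
     (\<forall>R::real. finite {(n, m). n \<noteq> m \<and>
        \<not> set_distance d (component V n) (component V m) > ereal R})"

definition coarse_disjoint_union_of_expanders ::
  "(nat \<Rightarrow> 'a pair_pre_digraph) \<Rightarrow> (nat \<times> 'a \<Rightarrow> nat \<times> 'a \<Rightarrow> real) \<Rightarrow> bool" where
  "coarse_disjoint_union_of_expanders G d \<longleftrightarrow>
     expander_sequence G \<and>
     coarse_disjoint_union (\<lambda>n. pverts (G n)) (\<lambda>n. graph_dist (G n)) d"

end

theory Submission
  imports Defs
begin

text \<open>
  Let \<open>g\<close> be a bijective coarse equivalence close to \<open>f\<close>. Components are connected by steps of
  length one, which \<open>g\<close> stretches by a bounded amount, while all but finitely many components of
  the target are far from the rest. Hence \<open>g\<close> maps all but finitely many components into single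
  components; the same holds for its inverse, so that \<open>g\<close> matches up cofinitely many components
  bijectively, and \<open>f\<close> follows \<open>g\<close>. What remains on both sides is finite and in bijection via \<open>g\<close>.

  Conversely, on all but finitely many matched components \<open>f\<close> has uniformly bounded fibres and
  uniformly dense image. Expansion of the target then gives Hall's condition for the relation
  \<open>d (f x) y \<le> R\<close> with a uniform \<open>R\<close>, and the resulting injections are
  bijections because the cardinalities agree. Finitely many components may be treated arbitrarily.
\<close>

section \<open>The marriage theorem\<close>

text \<open>Induction on \<open>I\<close> along a tight subset. If some nonempty proper
  \<open>J\<close> has exactly \<open>card J\<close> targets, match \<open>J\<close> and
  \<open>I - J\<close> separately, the latter outside the targets of \<open>J\<close>. Otherwise
  every nonempty proper subset has a spare target, so one index may be matched arbitrarily.\<close>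

lemma hall_marriage:
  fixes S :: "'i \<Rightarrow> 'b set"
  assumes "finite I" "\<And>i. i \<in> I \<Longrightarrow> finite (S i)"
    and "\<And>J. J \<subseteq> I \<Longrightarrow> card J \<le> card (\<Union>(S ` J))"
  shows "\<exists>f. inj_on f I \<and> (\<forall>i\<in>I. f i \<in> S i)"
  using assms
proof (induction I arbitrary: S rule: finite_psubset_induct)
  case (psubset I)
  note fin = psubset.prems(1) and hall = psubset.prems(2)
  have finU: "finite (\<Union>(S ` J))" if "J \<subseteq> I" for J
    using that psubset.hyps fin by (meson finite_UN_I finite_subset subsetD)
  consider "I = {}" | J where "J \<subset> I" "J \<noteq> {}" "card J = card (\<Union>(S ` J))"
    | "I \<noteq> {}" "\<And>J. J \<subset> I \<Longrightarrow> J \<noteq> {} \<Longrightarrow> card J < card (\<Union>(S ` J))"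
    using hall by (metis order_le_less psubset_imp_subset)
  then show ?case
  proof cases
    case 1
    then show ?thesis by simp
  next
    case (2 J)
    let ?U = "\<Union>(S ` J)"
    have "card K \<le> card (\<Union>(S ` K))" if "K \<subseteq> J" for K
      using hall that 2 by blast
    then have "\<exists>f. inj_on f J \<and> (\<forall>i\<in>J. f i \<in> S i)"
      using 2 fin by (intro psubset.IH) auto
    then obtain f where f: "inj_on f J" "\<forall>i\<in>J. f i \<in> S i" by blast
    \<comment> \<open>Hall's condition for \<open>K \<union> J\<close>, minus the targets of
      \<open>J\<close>, of which there are exactly \<open>card J\<close>.\<close>
    have hall': "card K \<le> card (\<Union>k\<in>K. S k - ?U)" if K: "K \<subseteq> I - J" for K
    proof -
      have sub: "K \<union> J \<subseteq> I" "K \<inter> J = {}" "finite K" "finite J"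
        using K 2 psubset.hyps finite_subset by blast+
      have "card K + card J = card (K \<union> J)"
        using sub by (simp add: card_Un_disjoint)
      also have "\<dots> \<le> card (\<Union>(S ` (K \<union> J)))"
        using hall sub by blast
      also have "\<Union>(S ` (K \<union> J)) = (\<Union>k\<in>K. S k - ?U) \<union> ?U" by blast
      also have "card \<dots> \<le> card (\<Union>k\<in>K. S k - ?U) + card ?U" by (rule card_Un_le)
      finally show ?thesis using 2 by simp
    qed
    have "\<exists>g. inj_on g (I - J) \<and> (\<forall>i\<in>I - J. g i \<in> S i - ?U)"
    proof (rule psubset.IH)
      show "I - J \<subset> I" using 2 by blast
    qed (use fin hall' in simp_all)
    then obtain g where g: "inj_on g (I - J)" "\<forall>i\<in>I - J. g i \<in> S i - ?U" by blast
    let ?f = "\<lambda>i. if i \<in> J then f i else g i"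
    have "f i \<noteq> g j" if "i \<in> J" "j \<in> I - J" for i j
      using f(2) g(2) that by fastforce
    then have "inj_on ?f I"
      unfolding inj_on_def using inj_onD[OF f(1)] inj_onD[OF g(1)] by (metis DiffI)
    moreover have "\<forall>i\<in>I. ?f i \<in> S i" using f g by simp
    ultimately show ?thesis by blast
  next
    case 3
    then obtain i where i: "i \<in> I" by blast
    have "S i \<noteq> {}" using hall[of "{i}"] i by auto
    then obtain x where x: "x \<in> S i" by blast
    \<comment> \<open>Removing \<open>x\<close> costs at most one target, which the strict
      inequality for proper subsets absorbs.\<close>
    have hall': "card K \<le> card (\<Union>k\<in>K. S k - {x})" if K: "K \<subseteq> I - {i}" for K
    proof (cases "K = {}")
      case False
      have "K \<subset> I" using K i by blast
      then have "card K < card (\<Union>(S ` K))" using 3 False by blast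
      moreover have "(\<Union>k\<in>K. S k - {x}) = \<Union>(S ` K) - {x}" by blast
      moreover have "card (\<Union>(S ` K)) - 1 \<le> card (\<Union>(S ` K) - {x})"
        using finU \<open>K \<subset> I\<close> by (simp add: card_Diff_singleton_if)
      ultimately show ?thesis by simp
    qed simp
    have "\<exists>g. inj_on g (I - {i}) \<and> (\<forall>j\<in>I - {i}. g j \<in> S j - {x})"
    proof (rule psubset.IH)
      show "I - {i} \<subset> I" using i by blast
    qed (use fin hall' in simp_all)
    then obtain g where g: "inj_on g (I - {i})" "\<forall>j\<in>I - {i}. g j \<in> S j - {x}" by blast
    have "inj_on (g(i := x)) I"
      using g by (auto simp: inj_on_def)
    moreover have "\<forall>j\<in>I. (g(i := x)) j \<in> S j" using g x by auto
    ultimately show ?thesis by blast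
  qed
qed

section \<open>Matchings in expanders\<close>

text \<open>The closed \<open>r\<close>-neighbourhood inside \<open>W\<close>. A witness in
  \<open>B\<close> replaces the distance to \<open>B\<close>, so the neighbourhood of the empty set
  is empty.\<close>

definition thicken :: "'a set \<Rightarrow> ('a \<Rightarrow> 'a \<Rightarrow> real) \<Rightarrow> real \<Rightarrow> 'a set \<Rightarrow> 'a set" where
  "thicken W d r B = {y \<in> W. \<exists>b\<in>B. d b y \<le> r}"

lemma thicken_subset: "thicken W d r B \<subseteq> W"
  by (auto simp: thicken_def)

lemma (in Metric_space) thicken_thicken:
  assumes "B \<subseteq> M"
  shows "thicken M d r (thicken M d s B) \<subseteq> thicken M d (s + r) B"
proof
  fix y assume "y \<in> thicken M d r (thicken M d s B)"
  then obtain b c where "y \<in> M" "b \<in> B" "c \<in> M" "d b c \<le> s" "d c y \<le> r"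
    by (auto simp: thicken_def)
  with triangle[of b c y] assms show "y \<in> thicken M d (s + r) B"
    by (force simp: thicken_def)
qed

lemma thicken_mono: "r \<le> s \<Longrightarrow> thicken W d r B \<subseteq> thicken W d s B"
  by (force simp: thicken_def)

text \<open>Iterating the expansion inequality: as long as a set fills at most half of the space, its
  1-neighbourhood is larger by a factor of \<open>1 + h / 2\<close>.\<close>

lemma (in Metric_space) expander_growth:
  assumes fin: "finite M" and h: "h > 0" and B: "B \<subseteq> M"
    and expand: "\<And>B. B \<subseteq> M \<Longrightarrow>
      (1 + h * (1 - real (card B) / real (card M))) * real (card B) \<le> real (card (thicken M d 1 B))"
  shows "(1 + h / 2) ^ p * real (card B) \<le> real (card (thicken M d (real p) B)) \<or>
    card M < 2 * card (thicken M d (real p) B)"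
proof (induction p)
  case 0
  have "B \<subseteq> thicken M d 0 B" using B by (force simp: thicken_def)
  then show ?case
    using card_mono[OF finite_subset[OF thicken_subset fin]] by fastforce
next
  case (Suc p)
  let ?T = "thicken M d (real p) B" and ?T' = "thicken M d (real (Suc p)) B"
  have mono: "card (thicken M d 1 ?T) \<le> card ?T'" "card ?T \<le> card ?T'"
    using thicken_thicken[OF B, of 1 "real p"] thicken_mono[of "real p" "real (Suc p)" M d B]
      finite_subset[OF thicken_subset fin]
    by (simp_all add: card_mono add.commute)
  show ?case
  proof (cases "card M < 2 * card ?T")
    case False
    then have IH: "(1 + h / 2) ^ p * real (card B) \<le> real (card ?T)" using Suc by blast
    \<comment> \<open>A set filling at most half of the space expands by at least
      \<open>h / 2\<close>. If \<open>M\<close> is empty, the quotient is 0.\<close>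
    have "real (card ?T) / real (card M) \<le> 1 / 2"
      using False by (cases "card M = 0") (auto simp: field_simps)
    then have "h * (1 / 2) \<le> h * (1 - real (card ?T) / real (card M))"
      using h by (intro mult_left_mono) auto
    then have "(1 + h / 2) * real (card ?T) \<le>
        (1 + h * (1 - real (card ?T) / real (card M))) * real (card ?T)"
      by (intro mult_right_mono) auto
    also have "\<dots> \<le> real (card (thicken M d 1 ?T))"
      by (rule expand[OF thicken_subset])
    also have "\<dots> \<le> real (card ?T')" using mono by simp
    finally have "(1 + h / 2) * real (card ?T) \<le> real (card ?T')" .
    moreover have "(1 + h / 2) * ((1 + h / 2) ^ p * real (card B)) \<le> (1 + h / 2) * real (card ?T)"
      using IH h by (intro mult_left_mono) auto
    ultimately show ?thesis by (simp add: mult.assoc)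
  qed (use mono in linarith)
qed

text \<open>Hall's condition for \<open>A\<close>: if the image of \<open>A\<close> does not grow to the size of \<open>A\<close> within distance
  \<open>p\<close>, it fills more than half of the space. The complement \<open>C\<close> of a larger neighbourhood then
  stays below one half while it grows, so that too many points would lie outside of \<open>A\<close>.\<close>

lemma (in Metric_space) expander_matching:
  assumes fin: "finite M" and h: "h > 0"
    and expand: "\<And>B. B \<subseteq> M \<Longrightarrow>
      (1 + h * (1 - real (card B) / real (card M))) * real (card B) \<le> real (card (thicken M d 1 B))"
    and V: "finite V" "card V = card M" and f: "f ` V \<subseteq> M"
    and fibres: "\<And>y. y \<in> M \<Longrightarrow> card {x \<in> V. f x = y} \<le> K"
    and balls: "\<And>x. x \<in> M \<Longrightarrow> card {y \<in> M. d x y \<le> c} \<le> K"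
    and dense: "\<And>y. y \<in> M \<Longrightarrow> \<exists>x\<in>V. d (f x) y \<le> c" and c: "c \<ge> 0"
    and p: "real K \<le> (1 + h / 2) ^ p"
  shows "\<exists>g. bij_betw g V M \<and> (\<forall>x\<in>V. d (f x) (g x) \<le> 2 * real p + c)"
proof -
  \<comment> \<open>One \<open>p\<close> lets the image of \<open>A\<close> grow, the other lets the
    complement of its neighbourhood grow, and \<open>c\<close> is the density constant.\<close>
  define R where "R = 2 * real p + c"
  define S where "S x = {y \<in> M. d (f x) y \<le> R}" for x
  have finT: "finite (thicken M d r B)" for r B
    using finite_subset[OF thicken_subset fin] .
  have "card A \<le> card (\<Union>(S ` A))" if A: "A \<subseteq> V" for A
  proof (rule ccontr)
    assume small: "\<not> card A \<le> card (\<Union>(S ` A))"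
    let ?B = "f ` A"
    have B: "?B \<subseteq> M" "finite A" "finite ?B" using A f V finite_subset by blast+
    have S: "\<Union>(S ` A) = thicken M d R ?B" by (auto simp: S_def thicken_def)
    \<comment> \<open>Fibres have at most \<open>K\<close> points, so \<open>A\<close> is at most
      \<open>K\<close> times as large as its image, and \<open>p\<close> growth steps make up for
      this factor.\<close>
    have "A \<subseteq> (\<Union>y\<in>?B. {x \<in> V. f x = y})" using A by blast
    then have "card A \<le> card (\<Union>y\<in>?B. {x \<in> V. f x = y})"
      using V B by (intro card_mono finite_UN_I) auto
    also have "\<dots> \<le> (\<Sum>y\<in>?B. card {x \<in> V. f x = y})" using B by (intro card_UN_le)
    also have "\<dots> \<le> (\<Sum>y\<in>?B. K)" using B fibres by (intro sum_mono) auto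
    finally have "real (card A) \<le> real K * real (card ?B)"
      by (simp add: mult.commute flip: of_nat_mult)
    also have "\<dots> \<le> (1 + h / 2) ^ p * real (card ?B)" by (intro mult_right_mono p) auto
    \<comment> \<open>Otherwise the \<open>p\<close>-neighbourhood, and hence the larger
      \<open>R\<close>-neighbourhood, of the image would have at least \<open>card A\<close>
      points.\<close>
    finally have "\<not> (1 + h / 2) ^ p * real (card ?B) \<le> real (card (thicken M d (real p) ?B))"
      using small card_mono[OF finT thicken_mono[of "real p" R M d ?B]] c
      unfolding S R_def by simp
    with expander_growth[OF fin h B(1) expand, of p]
    have half: "card M < 2 * card (thicken M d (real p) ?B)" by blast
    define C where "C = M - thicken M d R ?B"
    have C: "C \<subseteq> M" "finite C" using fin by (auto simp: C_def)
    have "card C + card (thicken M d R ?B) = card M"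
      unfolding C_def using card_Diff_subset[OF finT thicken_subset] card_mono[OF fin thicken_subset]
      by (metis le_add_diff_inverse2)
    \<comment> \<open>\<open>V\<close> and \<open>M\<close> have equal size, and the
      \<open>R\<close>-neighbourhood has fewer points than \<open>A\<close>.\<close>
    then have bigC: "card (V - A) < card C"
      using small V B A card_mono[OF V(1) A] by (simp add: S card_Diff_subset)
    \<comment> \<open>Of the radius \<open>R\<close>, moving by \<open>p\<close> away from
      \<open>C\<close> leaves \<open>p + c\<close>: the \<open>p\<close> separates the two
      \<open>p\<close>-neighbourhoods, the \<open>c\<close> keeps points of \<open>A\<close> from
      approximating points near \<open>C\<close>.\<close>
    have disj: "d (f a) y > real p + c" if "a \<in> A" "y \<in> thicken M d (real p) C" for a y
    proof -
      obtain z where z: "z \<in> C" "d z y \<le> real p" "y \<in> M" using \<open>y \<in> _\<close> by (auto simp: thicken_def)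
      then have "d (f a) z > R" using that by (auto simp: C_def thicken_def not_le)
      moreover have "d (f a) z \<le> d (f a) y + d z y"
        using triangle'[of "f a" y z] that A f z C by blast
      ultimately show ?thesis using z by (simp add: R_def)
    qed
    have "thicken M d (real p) C \<inter> thicken M d (real p) ?B = {}"
      using disj c by (force simp: thicken_def)
    then have "card (thicken M d (real p) C) + card (thicken M d (real p) ?B) \<le> card M"
      using card_Un_disjoint[OF finT finT, of "real p" C "real p" ?B]
        card_mono[OF fin, of "thicken M d (real p) C \<union> thicken M d (real p) ?B"]
      by (simp add: thicken_subset)
    \<comment> \<open>The \<open>p\<close>-neighbourhood of the image takes more than half of
      \<open>M\<close>, so that of \<open>C\<close> stays below half and the first alternative of
      growth applies.\<close>
    with half expander_growth[OF fin h C(1) expand, of p]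
    have "(1 + h / 2) ^ p * real (card C) \<le> real (card (thicken M d (real p) C))" by linarith
    moreover have "real K * real (card C) \<le> (1 + h / 2) ^ p * real (card C)"
      by (intro mult_right_mono p) auto
    ultimately have grow: "K * card C \<le> card (thicken M d (real p) C)"
      by (simp flip: of_nat_mult of_nat_le_iff)
    \<comment> \<open>By density each of these points is within \<open>c\<close> of some
      \<open>f x\<close>, and \<open>x\<close> cannot lie in \<open>A\<close>. Hence they are
      covered by \<open>card (V - A)\<close> balls of at most \<open>K\<close> points.\<close>
    have "thicken M d (real p) C \<subseteq> (\<Union>x\<in>V - A. {y \<in> M. d (f x) y \<le> c})"
    proof
      fix y assume y: "y \<in> thicken M d (real p) C"
      then have "y \<in> M" by (auto simp: thicken_def)
      with dense obtain x where x: "x \<in> V" "d (f x) y \<le> c" by blast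
      with disj[OF _ y] have "x \<notin> A" by force
      with x \<open>y \<in> M\<close> show "y \<in> (\<Union>x\<in>V - A. {y \<in> M. d (f x) y \<le> c})" by blast
    qed
    then have "card (thicken M d (real p) C) \<le> card (\<Union>x\<in>V - A. {y \<in> M. d (f x) y \<le> c})"
      using V fin by (intro card_mono finite_UN_I) auto
    also have "\<dots> \<le> (\<Sum>x\<in>V - A. card {y \<in> M. d (f x) y \<le> c})" using V by (intro card_UN_le) auto
    also have "\<dots> \<le> (\<Sum>x\<in>V - A. K)" using f balls by (intro sum_mono) auto
    also have "\<dots> = K * card (V - A)" by simp
    finally have "K * card C \<le> K * card (V - A)" using grow by linarith
    \<comment> \<open>Needed to cancel \<open>K\<close>: \<open>C\<close> is nonempty, and a ball
      contains its centre.\<close>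
    moreover have "K > 0"
    proof -
      obtain y where "y \<in> C" using bigC by (metis card.empty equals0I not_less_zero)
      then have "card {y' \<in> M. d y y' \<le> c} > 0"
        using C fin c by (auto simp: card_gt_0_iff intro!: exI[of _ y])
      then show ?thesis using balls[of y] \<open>y \<in> C\<close> C by force
    qed
    ultimately show False using bigC by simp
  qed
  then obtain g where g: "inj_on g V" "\<forall>x\<in>V. g x \<in> S x"
    using hall_marriage[of V S] V fin by (auto simp: S_def)
  have "g ` V \<subseteq> M" using g by (auto simp: S_def)
  then have "bij_betw g V M"
    using g V fin by (metis bij_betw_def card_image card_subset_eq)
  with g show ?thesis by (auto simp: S_def R_def)
qed

section \<open>Walks and distances in graphs\<close>

context pair_graph
begin

lemma graph_dist_arc_le_1:
  assumes "(u, v) \<in> parcs G"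
  shows "graph_dist G u v \<le> 1"
proof -
  have "awalk u [(u, v)] v" using assms by (simp add: awalk_simps in_arcsD1 in_arcsD2)
  from min_cost_le_walk_cost[OF this, of "\<lambda>_. 1"] show ?thesis
    by (simp add: graph_dist_def one_ereal_def)
qed

text \<open>The distance is an infimum of walk costs, and with unit weights the cost of a walk is
  its length.\<close>

lemma graph_dist_lessD:
  assumes "graph_dist G u v < ereal r"
  obtains p where "awalk u p v" "real (length p) < r"
proof -
  obtain p where "awalk u p v" "awalk_cost (\<lambda>_. 1) p < r"
    using assms by (auto simp: graph_dist_def \<mu>_def INF_less_iff)
  moreover have "awalk_cost (\<lambda>_. 1) p = real (length p)" by (induction p) auto
  ultimately show ?thesis using that by metis
qed

lemma awalk_in_closed_set:
  assumes "awalk u p v" "u \<in> S" "\<And>x y. (x, y) \<in> parcs G \<Longrightarrow> x \<in> S \<Longrightarrow> y \<in> S"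
  shows "v \<in> S"
  using assms by (induction p arbitrary: u) (auto simp: awalk_simps)

text \<open>A walk is trivial or starts with one of at most \<open>k\<close> arcs. The base
  \<open>Suc k\<close> leaves room for the trivial walk at each stage.\<close>

lemma card_awalk_ends_le:
  assumes deg: "\<And>v. v \<in> pverts G \<Longrightarrow> out_degree (with_proj G) v \<le> k"
    and u: "u \<in> pverts G"
  shows "card {v. \<exists>p. awalk u p v \<and> length p \<le> r} \<le> Suc k ^ r"
  using u
proof (induction r arbitrary: u)
  case 0
  have "{v. \<exists>p. awalk u p v \<and> length p \<le> 0} = {u}" using 0 by (auto simp: awalk_simps)
  then show ?case by simp
next
  case (Suc r)
  let ?E = "\<lambda>r u. {v. \<exists>p. awalk u p v \<and> length p \<le> r}"
  let ?A = "out_arcs (with_proj G) u"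
  have fin: "finite (?E r u)" for r u
    by (rule finite_subset[OF _ pair_finite_verts]) (auto intro: awalk_last_in_verts)
  have A: "finite ?A" "card ?A \<le> k" using deg[OF Suc.prems] by (auto simp: out_degree_def)
  have "?E (Suc r) u \<subseteq> insert u (\<Union>e\<in>?A. ?E r (snd e))"
  proof
    fix v assume "v \<in> ?E (Suc r) u"
    then obtain p where "awalk u p v" "length p \<le> Suc r" by blast
    then show "v \<in> insert u (\<Union>e\<in>?A. ?E r (snd e))"
      by (cases p) (auto simp: awalk_simps)
  qed
  then have "card (?E (Suc r) u) \<le> card (insert u (\<Union>e\<in>?A. ?E r (snd e)))"
    using A fin by (intro card_mono finite.insertI finite_UN_I) auto
  also have "\<dots> \<le> Suc (card (\<Union>e\<in>?A. ?E r (snd e)))"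
    by (rule card_insert_le_m1) auto
  also have "card (\<Union>e\<in>?A. ?E r (snd e)) \<le> (\<Sum>e\<in>?A. card (?E r (snd e)))"
    using A by (intro card_UN_le)
  also have "\<dots> \<le> (\<Sum>e\<in>?A. Suc k ^ r)"
    by (intro sum_mono Suc.IH) (auto intro: arc_snd_in_verts)
  also have "\<dots> \<le> k * Suc k ^ r" using A by simp
  also have "Suc (k * Suc k ^ r) \<le> Suc k ^ Suc r" by simp
  finally show ?case by simp
qed

end

section \<open>Coarse maps\<close>

text \<open>Asking for a nonnegative bound is harmless: any bound may be enlarged, and on the empty
  set the supremum is minus infinity.\<close>

lemma close_maps_iff: "close_maps X d f g \<longleftrightarrow> (\<exists>c\<ge>0. \<forall>x\<in>X. d (f x) (g x) \<le> c)"
proof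
  assume "close_maps X d f g"
  then have "\<exists>c. (SUP x\<in>X. ereal (d (f x) (g x))) \<le> ereal c"
    unfolding close_maps_def
    by (cases "SUP x\<in>X. ereal (d (f x) (g x))") auto
  then obtain c where "(SUP x\<in>X. ereal (d (f x) (g x))) \<le> ereal c" ..
  then have "\<forall>x\<in>X. d (f x) (g x) \<le> c" by (simp add: SUP_le_iff)
  then have "\<forall>x\<in>X. d (f x) (g x) \<le> max c 0" by force
  then show "\<exists>c\<ge>0. \<forall>x\<in>X. d (f x) (g x) \<le> c" by (metis max.cobounded2)
next
  assume "\<exists>c\<ge>0. \<forall>x\<in>X. d (f x) (g x) \<le> c"
  then obtain c where "\<forall>x\<in>X. d (f x) (g x) \<le> c" by blast
  then have "(SUP x\<in>X. ereal (d (f x) (g x))) \<le> ereal c" by (simp add: SUP_le_iff)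
  then show "close_maps X d f g" unfolding close_maps_def by (rule le_less_trans) simp
qed

lemma coarse_mapD:
  assumes "coarse_map X dX Y dY f"
  shows "\<exists>s>0. \<forall>x\<in>X. \<forall>z\<in>X. dX x z \<le> r \<longrightarrow> dY (f x) (f z) \<le> s"
proof -
  \<comment> \<open>The maximum is positive, as the definition demands, and exceeds
    \<open>r\<close>, so the strict bound there covers the non-strict one here, for any real
    \<open>r\<close>.\<close>
  obtain s where "s > 0" "\<forall>x\<in>X. \<forall>z\<in>X. dX x z < max (r + 1) 1 \<longrightarrow> dY (f x) (f z) < s"
    using assms unfolding coarse_map_def by (meson max.strict_coboundedI2 zero_less_one)
  moreover have "a < max (r + 1) 1" if "a \<le> r" for a using that by linarith
  ultimately show ?thesis by (meson less_imp_le)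
qed

lemma coarse_mapI:
  assumes "f ` X \<subseteq> Y" "\<And>r. r > 0 \<Longrightarrow> \<exists>s. \<forall>x\<in>X. \<forall>z\<in>X. dX x z \<le> r \<longrightarrow> dY (f x) (f z) \<le> s"
  shows "coarse_map X dX Y dY f"
  unfolding coarse_map_def
proof (intro conjI allI impI assms)
  fix r :: real assume "r > 0"
  then obtain s where s: "\<forall>x\<in>X. \<forall>z\<in>X. dX x z \<le> r \<longrightarrow> dY (f x) (f z) \<le> s" using assms by blast
  then have "\<forall>x\<in>X. \<forall>z\<in>X. dX x z < r \<longrightarrow> dY (f x) (f z) < max (s + 1) 1" 
    by force
  then show "\<exists>s>0. \<forall>x\<in>X. \<forall>z\<in>X. dX x z < r \<longrightarrow> dY (f x) (f z) < s"
    by (intro exI[of _ "max (s + 1) 1"]) auto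
qed

lemma coarse_map_close:
  assumes "Metric_space Y dY" "coarse_map X dX Y dY f" "close_maps X dY f g" "g ` X \<subseteq> Y"
  shows "coarse_map X dX Y dY g"
proof (rule coarse_mapI)
  interpret Metric_space Y dY by fact
  fix r :: real
  have fY: "f ` X \<subseteq> Y" using assms(2) by (simp add: coarse_map_def)
  obtain s where s: "\<forall>x\<in>X. \<forall>z\<in>X. dX x z \<le> r \<longrightarrow> dY (f x) (f z) \<le> s"
    using coarse_mapD[OF assms(2), of r] by blast
  obtain c where c: "\<forall>x\<in>X. dY (f x) (g x) \<le> c" using assms(3) unfolding close_maps_iff by blast
  have "dY (g x) (g z) \<le> c + s + c" if "x \<in> X" "z \<in> X" "dX x z \<le> r" for x z
  proof -
    have "dY (g x) (g z) \<le> dY (f x) (g x) + dY (f x) (g z)"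
      using triangle''[of "g x" "f x" "g z"] that fY assms(4) by blast
    moreover have "dY (f x) (g z) \<le> dY (f x) (f z) + dY (f z) (g z)"
      using triangle[of "f x" "f z" "g z"] that fY assms(4) by blast
    moreover have "dY (f x) (g x) \<le> c" "dY (f z) (g z) \<le> c" "dY (f x) (f z) \<le> s"
      using that s c by blast+
    ultimately show ?thesis by linarith
  qed
  then show "\<exists>s. \<forall>x\<in>X. \<forall>z\<in>X. dX x z \<le> r \<longrightarrow> dY (g x) (g z) \<le> s" by blast
qed fact

text \<open>The coarse inverse \<open>k\<close> of \<open>f\<close> also serves \<open>g\<close>:
  \<open>k (g x)\<close> is near \<open>k (f x)\<close> since \<open>k\<close> is coarse, and
  \<open>g (k y)\<close> is near \<open>f (k y)\<close> by closeness at \<open>k y\<close>.\<close>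

lemma coarse_equivalence_close:
  assumes X: "Metric_space X dX" and Y: "Metric_space Y dY"
    and f: "coarse_equivalence X dX Y dY f" and fg: "close_maps X dY f g" and g: "g ` X \<subseteq> Y"
  shows "coarse_equivalence X dX Y dY g"
proof -
  interpret X: Metric_space X dX by fact
  interpret Y: Metric_space Y dY by fact
  obtain k where cf: "coarse_map X dX Y dY f" and k: "coarse_map Y dY X dX k"
    "close_maps X dX (k \<circ> f) id" "close_maps Y dY (f \<circ> k) id"
    using f by (auto simp: coarse_equivalence_def)
  have im: "f ` X \<subseteq> Y" "k ` Y \<subseteq> X" using cf k by (auto simp: coarse_map_def)
  obtain c where c: "\<forall>x\<in>X. dY (f x) (g x) \<le> c" using fg unfolding close_maps_iff by blast
  obtain a where a: "\<forall>x\<in>X. dX (k (f x)) x \<le> a" using k unfolding close_maps_iff by auto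
  obtain b where b: "\<forall>y\<in>Y. dY (f (k y)) y \<le> b" using k unfolding close_maps_iff by auto
  obtain s where s: "s > 0" "\<forall>y\<in>Y. \<forall>z\<in>Y. dY y z \<le> c \<longrightarrow> dX (k y) (k z) \<le> s"
    using coarse_mapD[OF k(1), of c] by blast
  have "dX (k (g x)) x \<le> s + a" if "x \<in> X" for x
  proof -
    have "f x \<in> Y" "g x \<in> Y" "k (f x) \<in> X" "k (g x) \<in> X" using im g that by blast+
    then show ?thesis
      using X.triangle''[of "k (g x)" "k (f x)" x] s c a that by fastforce
  qed
  then have 1: "close_maps X dX (k \<circ> g) id"
    by (auto simp: close_maps_iff intro!: exI[of _ "max (s + a) 0"] le_max_iff_disj[THEN iffD2])
  have "dY (g (k y)) y \<le> c + b" if "y \<in> Y" for y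
  proof -
    have "k y \<in> X" "f (k y) \<in> Y" "g (k y) \<in> Y" using im g that by blast+
    then show ?thesis
      using Y.triangle''[of "g (k y)" "f (k y)" y] c b that by fastforce
  qed
  then have 2: "close_maps Y dY (g \<circ> k) id"
    by (auto simp: close_maps_iff intro!: exI[of _ "max (c + b) 0"] le_max_iff_disj[THEN iffD2])
  show ?thesis
    using coarse_map_close[OF Y cf fg g] k(1) 1 2 by (auto simp: coarse_equivalence_def)
qed

text \<open>The set-theoretic inverse is close to any coarse inverse \<open>k\<close>: at
  \<open>y = g x\<close> it takes the value \<open>x\<close>, which is near
  \<open>k (g x)\<close>.\<close>

lemma coarse_map_inverse:
  assumes X: "Metric_space X dX" and g: "bijective_coarse_equivalence X dX Y dY g"
  shows "coarse_map Y dY X dX (inv_into X g)"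
proof -
  interpret X: Metric_space X dX by fact
  have bij: "bij_betw g X Y" using g by (simp add: bijective_coarse_equivalence_def)
  obtain k where k: "coarse_map Y dY X dX k" "close_maps X dX (k \<circ> g) id"
    using g by (auto simp: coarse_equivalence_def bijective_coarse_equivalence_def)
  obtain a where a: "a \<ge> 0" "\<forall>x\<in>X. dX (k (g x)) x \<le> a" using k unfolding close_maps_iff by auto
  have "dX (k y) (inv_into X g y) \<le> a" if "y \<in> Y" for y
    using a(2) bij_betw_inv_into_right[OF bij that] bij_betw_apply[OF bij_betw_inv_into[OF bij] that]
    by metis
  then have "close_maps Y dX k (inv_into X g)" using a unfolding close_maps_iff by blast
  then show ?thesis
    using coarse_map_close[OF X k(1)] bij_betw_imp_surj_on[OF bij_betw_inv_into[OF bij]] by simp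
qed

section \<open>Coarse disjoint unions of expanders\<close>

lemma mem_component: "x \<in> component V n \<longleftrightarrow> x \<in> disjoint_union V \<and> fst x = n"
  by (cases x) (auto simp: component_def disjoint_union_def)

lemma card_component [simp]: "card (component V n) = card (V n)"
  by (simp add: component_def card_cartesian_product_singleton)

lemma component_subset: "component V n \<subseteq> disjoint_union V"
  by (auto simp: mem_component)

lemma in_component_fst: "x \<in> disjoint_union V \<Longrightarrow> x \<in> component V (fst x)"
  by (simp add: mem_component)

lemma image_component_subsetD:
  assumes "g ` S \<subseteq> component V m" "x \<in> S"
  shows "g x \<in> component V m" "g x \<in> disjoint_union V" "fst (g x) = m"
proof -
  show "g x \<in> component V m" using assms by (rule subsetD[OF _ imageI])
  then show "g x \<in> disjoint_union V" "fst (g x) = m" by (simp_all add: mem_component)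
qed

lemma card_Union_components:
  assumes "finite I" "\<And>n. finite (V n)"
  shows "card (\<Union>n\<in>I. component V n) = (\<Sum>n\<in>I. card (V n))"
  using assms by (subst card_UN_disjoint) (auto simp: component_def)

lemma Union_components_Diff:
  "(\<Union>n\<in>UNIV - I. component V n) = disjoint_union V - (\<Union>n\<in>I. component V n)"
  by (auto simp: mem_component)

section \<open>Geometry of one coarse disjoint union: isolation, connectedness, ball sizes and
  expansion of components\<close>

locale expander_union =
  fixes G :: "nat \<Rightarrow> 'a pair_pre_digraph" and d :: "nat \<times> 'a \<Rightarrow> nat \<times> 'a \<Rightarrow> real"
  assumes union: "coarse_disjoint_union_of_expanders G d"
begin

abbreviation "points \<equiv> disjoint_union (\<lambda>n. pverts (G n))"
abbreviation "part \<equiv> component (\<lambda>n. pverts (G n))"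

sublocale Metric_space points d
  using union by (simp add: coarse_disjoint_union_of_expanders_def coarse_disjoint_union_def)

lemma part_metric_space: "Metric_space (part n) d"
  by (rule subspace[OF component_subset])

lemma finite_part: "finite (part n)"
  using union
  by (simp add: coarse_disjoint_union_of_expanders_def coarse_disjoint_union_def component_def)

lemma pair_graph: "pair_graph (G n)"
  using union unfolding coarse_disjoint_union_of_expanders_def expander_sequence_def
    expander_graph_def by blast

lemma graph_dist_eq:
  "\<lbrakk>x \<in> pverts (G n); y \<in> pverts (G n)\<rbrakk> \<Longrightarrow> graph_dist (G n) x y = ereal (d (n, x) (n, y))"
  using union by (simp add: coarse_disjoint_union_of_expanders_def coarse_disjoint_union_def)

text \<open>The cardinalities tend to infinity. Empty components must be set aside because a map
  does not determine where they go.\<close>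

lemma finite_empty_part: "finite {n. part n = {}}"
proof -
  have "filterlim (\<lambda>n. card (pverts (G n))) at_top sequentially"
    using union
    by (simp add: coarse_disjoint_union_of_expanders_def expander_sequence_def)
  then have "\<forall>\<^sub>F n in sequentially. 1 \<le> card (pverts (G n))"
    by (simp add: filterlim_at_top)
  then have "finite {n. \<not> 1 \<le> card (pverts (G n))}"
    by (simp add: eventually_cofinite flip: cofinite_eq_sequentially)
  then show ?thesis
    by (rule finite_subset[rotated]) (auto simp: component_def)
qed

text \<open>The separation of components in terms of points: if \<open>n\<close> is not in
  \<open>crowded R\<close>, every point within \<open>R\<close> of \<open>part n\<close> already
  lies in \<open>part n\<close>.\<close>

definition crowded :: "real \<Rightarrow> nat set" where
  "crowded R = {n. \<exists>m x y. m \<noteq> n \<and> x \<in> part n \<and> y \<in> part m \<and> d x y \<le> R}"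

lemma finite_crowded: "finite (crowded R)"
proof -
  let ?P = "{(n, m). n \<noteq> m \<and> \<not> set_distance d (part n) (part m) > ereal R}"
  have "crowded R \<subseteq> fst ` ?P"
  proof
    fix n assume "n \<in> crowded R"
    then obtain m x y where *: "m \<noteq> n" "x \<in> part n" "y \<in> part m" "d x y \<le> R"
      by (auto simp: crowded_def)
    have "(INF b\<in>part m. ereal (d x b)) \<le> ereal R"
      by (rule INF_lower2[OF *(3)]) (simp add: *)
    then have "set_distance d (part n) (part m) \<le> ereal R"
      unfolding set_distance_def by (rule INF_lower2[OF *(2)])
    with * have "(n, m) \<in> ?P" by (simp add: not_less)
    then show "n \<in> fst ` ?P" by (rule rev_image_eqI) simp
  qed
  moreover have "finite ?P"
    using union by (simp add: coarse_disjoint_union_of_expanders_def coarse_disjoint_union_def)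
  ultimately show ?thesis by (rule finite_subset[OF _ finite_imageI])
qed

lemma crowdedI:
  assumes "x \<in> points" "y \<in> points" "d x y \<le> R" "fst x \<noteq> fst y"
  shows "fst x \<in> crowded R" "fst y \<in> crowded R"
proof -
  have x: "x \<in> part (fst x)" and y: "y \<in> part (fst y)" using assms in_component_fst by blast+
  show "fst x \<in> crowded R" unfolding crowded_def using assms(3) not_sym[OF assms(4)] x y by blast
  have "d y x \<le> R" using assms commute by metis
  then show "fst y \<in> crowded R" unfolding crowded_def using assms(4) x y by blast
qed

text \<open>An induction principle along unit steps. The metric is real valued, so any two points of
  a component are joined by a walk.\<close>

lemma part_connected:
  assumes x: "x \<in> part n" and y: "y \<in> part n" and P: "P x"
    and step: "\<And>u v. \<lbrakk>u \<in> part n; v \<in> part n; d u v \<le> 1; P u\<rbrakk> \<Longrightarrow> P v"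
  shows "P y"
proof -
  interpret pair_graph "G n" by (rule pair_graph)
  obtain a b where ab: "x = (n, a)" "y = (n, b)" "a \<in> pverts (G n)" "b \<in> pverts (G n)"
    using x y by (auto simp: component_def)
  have "graph_dist (G n) a b < ereal (d x y + 1)"
    using graph_dist_eq ab by simp
  then obtain p where "awalk a p b" by (rule graph_dist_lessD)
  then have "b \<in> {b \<in> pverts (G n). P (n, b)}"
  proof (rule awalk_in_closed_set)
    fix u v assume uv: "(u, v) \<in> parcs (G n)" "u \<in> {b \<in> pverts (G n). P (n, b)}"
    then have "v \<in> pverts (G n)" using in_arcsD2 by blast
    moreover have "d (n, u) (n, v) \<le> 1"
      using graph_dist_arc_le_1[OF uv(1)] graph_dist_eq[of u n v] uv calculation by simp
    ultimately show "v \<in> {b \<in> pverts (G n). P (n, b)}"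
      using uv step[of "(n, u)" "(n, v)"] by (auto simp: component_def)
  qed (use P ab in simp)
  then show ?thesis using ab by simp
qed

text \<open>The degree bound \<open>k\<close> is common to all graphs, so counting ends of walks
  gives one bound for all components.\<close>

lemma card_balls_bounded: "\<exists>K. \<forall>n. \<forall>x\<in>part n. card {y \<in> part n. d x y \<le> c} \<le> K"
proof -
  obtain k where deg: "\<And>n v. v \<in> pverts (G n) \<Longrightarrow> out_degree (with_proj (G n)) v \<le> k"
    using union unfolding coarse_disjoint_union_of_expanders_def expander_sequence_def
      expander_graph_def by blast
  obtain r :: nat where r: "c < real r" using reals_Archimedean2 by blast
  have "card {y \<in> part n. d x y \<le> c} \<le> Suc k ^ r" if x: "x \<in> part n" for n x
  proof -
    interpret pair_graph "G n" by (rule pair_graph)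
    obtain u where u: "x = (n, u)" "u \<in> pverts (G n)" using x by (auto simp: component_def)
    let ?E = "{v. \<exists>p. awalk u p v \<and> length p \<le> r}"
    have fin: "finite ?E"
      by (rule finite_subset[OF _ pair_finite_verts]) (auto intro: awalk_last_in_verts)
    have "{y \<in> part n. d x y \<le> c} \<subseteq> Pair n ` ?E"
    proof
      fix y assume "y \<in> {y \<in> part n. d x y \<le> c}"
      then obtain v where v: "y = (n, v)" "v \<in> pverts (G n)" "d x y \<le> c"
        by (auto simp: component_def)
      then have "graph_dist (G n) u v < ereal (real r)" using u r graph_dist_eq by simp
      then obtain p where "awalk u p v" "real (length p) < real r" by (rule graph_dist_lessD)
      then show "y \<in> Pair n ` ?E" using v by force
    qed
    then have "card {y \<in> part n. d x y \<le> c} \<le> card (Pair n ` ?E)"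
      using fin by (intro card_mono) auto
    also have "\<dots> \<le> card ?E" using fin by (rule card_image_le)
    also have "\<dots> \<le> Suc k ^ r" using deg u by (intro card_awalk_ends_le)
    finally show ?thesis .
  qed
  then show ?thesis by blast
qed

text \<open>The 1-neighbourhood of \<open>B\<close> contains the disjoint sets \<open>B\<close> and
  its boundary; adding \<open>card B\<close> to the boundary estimate produces the summand 1 in the
  factor.\<close>

lemma thicken_expands:
  obtains h where "h > 0" "\<And>n B. B \<subseteq> part n \<Longrightarrow>
    (1 + h * (1 - real (card B) / real (card (part n)))) * real (card B)
      \<le> real (card (thicken (part n) d 1 B))"
proof -
  obtain h where h: "h > 0" "\<And>n A. A \<subseteq> pverts (G n) \<Longrightarrow> real (card (boundary (G n) A))
      \<ge> h * (1 - real (card A) / real (card (pverts (G n)))) * real (card A)"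
    using union unfolding coarse_disjoint_union_of_expanders_def expander_sequence_def
      expander_graph_def by blast
  have "(1 + h * (1 - real (card B) / real (card (part n)))) * real (card B)
      \<le> real (card (thicken (part n) d 1 B))" if B: "B \<subseteq> part n" for n B
  proof -
    define A where "A = snd ` B"
    have A: "A \<subseteq> pverts (G n)" and B_eq: "B = Pair n ` A"
      using B by (force simp: component_def A_def)+
    have card: "card (Pair n ` C) = card C" for C :: "'a set"
      by (simp add: card_image inj_on_def)
    have finA: "finite A" using finite_subset[OF B finite_part] by (simp add: A_def)
    have "Pair n ` boundary (G n) A \<union> B \<subseteq> thicken (part n) d 1 B"
    proof (rule Un_least)
      show "B \<subseteq> thicken (part n) d 1 B"
        using B component_subset by (force simp: thicken_def)
      show "Pair n ` boundary (G n) A \<subseteq> thicken (part n) d 1 B"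
      proof
        fix y assume "y \<in> Pair n ` boundary (G n) A"
        then obtain x where x: "y = (n, x)" "x \<in> pverts (G n)"
            "(INF a\<in>A. graph_dist (G n) x a) \<le> 1"
          by (auto simp: boundary_def)
        \<comment> \<open>The infimum over the empty set is infinity; over a finite nonempty set it
          is attained.\<close>
        have "A \<noteq> {}" using x(3) by (auto simp: top_ereal_def)
        then have "(INF a\<in>A. graph_dist (G n) x a) \<in> graph_dist (G n) x ` A"
          using finA by (metis Min_in cInf_eq_Min finite_imageI image_is_empty)
        then obtain a where a: "a \<in> A" "graph_dist (G n) x a \<le> 1" using x(3) by auto
        then have "d (n, a) y \<le> 1" using x A graph_dist_eq[of x n a] commute by auto
        then show "y \<in> thicken (part n) d 1 B"
          using a x B_eq by (auto simp: thicken_def component_def)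
      qed
    qed
    then have "card (Pair n ` boundary (G n) A \<union> B) \<le> card (thicken (part n) d 1 B)"
      by (intro card_mono finite_subset[OF thicken_subset finite_part])
    moreover have "card (Pair n ` boundary (G n) A \<union> B) = card (boundary (G n) A) + card B"
    proof -
      have "finite (boundary (G n) A)"
        using finite_part[of n] by (auto simp: boundary_def component_def finite_cartesian_product_iff)
      moreover have "Pair n ` boundary (G n) A \<inter> B = {}" by (auto simp: B_eq boundary_def)
      ultimately show ?thesis
        using finA by (subst card_Un_disjoint) (auto simp: card B_eq)
    qed
    moreover have "card B = card A" by (simp add: B_eq card)
    ultimately show ?thesis using h(2)[OF A] by (simp add: algebra_simps)
  qed
  with h(1) show ?thesis by (rule that)
qed

end

section \<open>Maps between two coarse disjoint unions\<close>

locale expander_union_pair = A: expander_union G dX + B: expander_union H dY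
  for G :: "nat \<Rightarrow> 'a pair_pre_digraph" and dX and H :: "nat \<Rightarrow> 'b pair_pre_digraph" and dY
begin

text \<open>Finitely many target components contain finitely many points, whose preimage under an
  injective map is finite.\<close>

lemma finite_meeting_parts:
  assumes "inj_on g A.points" "finite F"
  shows "finite {n. \<exists>x\<in>A.part n. fst (g x) \<in> F \<and> g x \<in> B.points}"
proof -
  have "finite (\<Union>m\<in>F. B.part m)" using assms B.finite_part by blast
  then have "finite (fst ` (g -` (\<Union>m\<in>F. B.part m) \<inter> A.points))"
    using assms by (intro finite_imageI finite_vimage_IntI)
  moreover have "n \<in> fst ` (g -` (\<Union>m\<in>F. B.part m) \<inter> A.points)"
    if "x \<in> A.part n" "fst (g x) \<in> F" "g x \<in> B.points" for n x
    using that by (intro rev_image_eqI[of x]) (auto simp: mem_component)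
  ultimately show ?thesis by (elim finite_subset[rotated]) blast
qed

text \<open>Unit steps are mapped to steps of length at most \<open>s\<close>. These cannot leave a
  component outside \<open>B.crowded s\<close>, so a connected component whose image avoids crowded
  components stays in one component.\<close>

lemma finite_torn_parts:
  assumes g: "coarse_map A.points dX B.points dY g" and inj: "inj_on g A.points"
  shows "finite {n. \<nexists>m. g ` A.part n \<subseteq> B.part m}"
proof -
  have im: "g ` A.points \<subseteq> B.points" using g by (simp add: coarse_map_def)
  obtain s where s: "\<forall>x\<in>A.points. \<forall>z\<in>A.points. dX x z \<le> 1 \<longrightarrow> dY (g x) (g z) \<le> s"
    using coarse_mapD[OF g, of 1] by blast
  let ?bad = "{n. \<exists>x\<in>A.part n. fst (g x) \<in> B.crowded s \<and> g x \<in> B.points}"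
  have "\<exists>m. g ` A.part n \<subseteq> B.part m" if n: "n \<notin> ?bad" for n
  proof (cases "A.part n = {}")
    case False
    then obtain x where x: "x \<in> A.part n" by blast
    have "fst (g y) = fst (g x)" if "y \<in> A.part n" for y
    proof (rule A.part_connected[OF x that])
      fix u v assume uv: "u \<in> A.part n" "v \<in> A.part n" "dX u v \<le> 1" "fst (g u) = fst (g x)"
      then have "u \<in> A.points" "v \<in> A.points" by (auto simp: mem_component)
      then have "g u \<in> B.points" "g v \<in> B.points" "dY (g u) (g v) \<le> s"
        using im s uv by blast+
      moreover from this have "fst (g u) \<notin> B.crowded s" using n uv(1) by blast
      ultimately show "fst (g v) = fst (g x)"
        using B.crowdedI(1)[of "g u" "g v" s] uv(4) by metis
    qed simp
    then have "g ` A.part n \<subseteq> B.part (fst (g x))"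
      using im by (simp add: mem_component image_subset_iff)
    then show ?thesis by blast
  qed auto
  then have "{n. \<nexists>m. g ` A.part n \<subseteq> B.part m} \<subseteq> ?bad" by blast
  then show ?thesis
    using finite_meeting_parts[OF inj B.finite_crowded] by (rule finite_subset)
qed

section \<open>Coarse equivalences and matched components\<close>

text \<open>Condition (2) of the theorem, named so that the two implications can be stated
  separately.\<close>

definition matched :: "(nat \<times> 'a \<Rightarrow> nat \<times> 'b) \<Rightarrow> nat set \<Rightarrow> nat set \<Rightarrow> (nat \<Rightarrow> nat) \<Rightarrow> bool" where
  "matched f N M i \<longleftrightarrow> finite (UNIV - N) \<and> finite (UNIV - M) \<and> bij_betw i N M \<and>
     (\<Sum>n\<in>UNIV - N. card (pverts (G n))) = (\<Sum>n\<in>UNIV - M. card (pverts (H n))) \<and>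
     (\<forall>n\<in>N. card (pverts (G n)) = card (pverts (H (i n))) \<and> f ` A.part n \<subseteq> B.part (i n))"

lemma finite_pverts: "finite (pverts (G n))" "finite (pverts (H n))"
  using A.pair_graph[of n] B.pair_graph[of n]
  by (auto simp: pair_graph_def pair_digraph_def dest: pair_fin_digraph.pair_finite_verts)

lemma matched_if_bijective:
  assumes g: "bijective_coarse_equivalence A.points dX B.points dY g"
    and f: "f ` A.points \<subseteq> B.points" and fg: "close_maps A.points dY f g"
  shows "\<exists>N M i. matched f N M i"
proof -
  \<comment> \<open>With the roles exchanged, the finiteness results apply to the inverse of
    \<open>g\<close> as well.\<close>
  interpret inv: expander_union_pair H dY G dX ..
  have bij: "bij_betw g A.points B.points" and coarse: "coarse_map A.points dX B.points dY g"
    using g by (auto simp: bijective_coarse_equivalence_def coarse_equivalence_def)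
  then have inj: "inj_on g A.points" and im: "g ` A.points = B.points"
    by (auto simp: bij_betw_def)
  let ?k = "inv_into A.points g"
  have kbij: "bij_betw ?k B.points A.points" using bij by (rule bij_betw_inv_into)
  then have kinj: "inj_on ?k B.points" and kim: "?k ` B.points = A.points"
    by (auto simp: bij_betw_def)
  have gk: "g (?k y) = y" if "y \<in> B.points" for y using that im by (simp add: f_inv_into_f)
  have kg: "?k (g x) = x" if "x \<in> A.points" for x using that inj by simp
  obtain c where c: "\<forall>x\<in>A.points. dY (f x) (g x) \<le> c" using fg unfolding close_maps_iff by blast
  define badX where "badX = {n. \<nexists>m. g ` A.part n \<subseteq> B.part m}"
  define badY where "badY = {m. \<nexists>n. ?k ` B.part m \<subseteq> A.part n}"
  \<comment> \<open>Nonemptiness makes the index \<open>m\<close> unique and the resulting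
    \<open>i\<close> injective.\<close>
  define N where "N = {n. A.part n \<noteq> {} \<and> (\<exists>m. g ` A.part n = B.part m \<and> f ` A.part n \<subseteq> B.part m)}"
  define i where "i n = (SOME m. g ` A.part n = B.part m \<and> f ` A.part n \<subseteq> B.part m)" for n
  have i: "g ` A.part n = B.part (i n)" "f ` A.part n \<subseteq> B.part (i n)" if "n \<in> N" for n
    using that someI_ex[of "\<lambda>m. g ` A.part n = B.part m \<and> f ` A.part n \<subseteq> B.part m"]
    by (auto simp: N_def i_def)
  have "finite badX" unfolding badX_def by (rule finite_torn_parts[OF coarse inj])
  have "finite badY"
    unfolding badY_def by (rule inv.finite_torn_parts[OF coarse_map_inverse[OF A.Metric_space_axioms g] kinj])
  \<comment> \<open>Target components to avoid: those torn by the inverse of \<open>g\<close>, and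
    those from which a displacement by \<open>c\<close>, the distance between \<open>f\<close> and
    \<open>g\<close>, may escape.\<close>
  define F where "F = badY \<union> B.crowded c"
  have "finite F" using \<open>finite badY\<close> B.finite_crowded by (simp add: F_def)
  have N_I: "n \<in> N" if n: "n \<notin> badX" "A.part n \<noteq> {}"
    "n \<notin> {n. \<exists>x\<in>A.part n. fst (g x) \<in> F \<and> g x \<in> B.points}" for n
  proof -
    obtain m where m: "g ` A.part n \<subseteq> B.part m" using n by (auto simp: badX_def)
    obtain x where x: "x \<in> A.part n" using n by blast
    have "g x \<in> B.points" "fst (g x) = m" using image_component_subsetD[OF m x] by simp_all
    then have "m \<notin> F" using n x by blast
    then obtain n' where n': "?k ` B.part m \<subseteq> A.part n'" by (auto simp: F_def badY_def)
    have "?k (g x) \<in> A.part n'"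
      using n' image_component_subsetD(1)[OF m x] by blast
    \<comment> \<open>The inverse sends \<open>g x\<close> back to \<open>x\<close>, which
      identifies the component that receives \<open>B.part m\<close>.\<close>
    then have "n' = n" using x kg[of x] by (simp add: mem_component)
    have "B.part m \<subseteq> g ` A.part n"
    proof
      fix y assume "y \<in> B.part m"
      then have "?k y \<in> A.part n" "y \<in> B.points"
        using n' \<open>n' = n\<close> component_subset by blast+
      then show "y \<in> g ` A.part n" using gk[of y] by (metis imageI)
    qed
    moreover have "f ` A.part n \<subseteq> B.part m"
    proof (rule image_subsetI)
      fix z assume z: "z \<in> A.part n"
      then have "z \<in> A.points" by (simp add: mem_component)
      then have "f z \<in> B.points" "g z \<in> B.points" "dY (f z) (g z) \<le> c" using f im c by auto
      moreover have "fst (g z) = m" using image_component_subsetD(3)[OF m z] .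
      ultimately show "f z \<in> B.part m"
        using B.crowdedI(2)[of "f z" "g z" c] \<open>m \<notin> F\<close> by (auto simp: F_def mem_component)
    qed
    ultimately have "g ` A.part n = B.part m \<and> f ` A.part n \<subseteq> B.part m" using m by blast
    then show ?thesis using n(2) unfolding N_def by blast
  qed
  have "UNIV - N \<subseteq> badX \<union> {n. A.part n = {}} \<union>
      {n. \<exists>x\<in>A.part n. fst (g x) \<in> F \<and> g x \<in> B.points}"
    using N_I by blast
  then have finN: "finite (UNIV - N)"
    using \<open>finite badX\<close> A.finite_empty_part finite_meeting_parts[OF inj \<open>finite F\<close>]
    by (meson finite_UnI finite_subset)
  \<comment> \<open>A single point of \<open>B.part m\<close> whose preimage lies in a component
    indexed by \<open>N\<close> forces \<open>m\<close> to be a value of \<open>i\<close>.\<close>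
  have "m \<in> i ` N" if m: "m \<notin> badY" "B.part m \<noteq> {}"
    "m \<notin> {m. \<exists>y\<in>B.part m. fst (?k y) \<in> UNIV - N \<and> ?k y \<in> A.points}" for m
  proof -
    obtain y where y: "y \<in> B.part m" using m by blast
    have "y \<in> B.points" using y by (simp add: mem_component)
    then have "?k y \<in> A.points" using kim by blast
    then have "fst (?k y) \<in> N" using m y by blast
    moreover have "?k y \<in> A.part (fst (?k y))" using \<open>?k y \<in> A.points\<close> by (rule in_component_fst)
    ultimately have "y \<in> B.part (i (fst (?k y)))" using i(1) gk[OF \<open>y \<in> B.points\<close>] by (metis imageI)
    then show ?thesis using y \<open>fst (?k y) \<in> N\<close> by (auto simp: mem_component)
  qed
  then have "UNIV - i ` N \<subseteq> badY \<union> {m. B.part m = {}} \<union>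
      {m. \<exists>y\<in>B.part m. fst (?k y) \<in> UNIV - N \<and> ?k y \<in> A.points}"
    by blast
  then have finM: "finite (UNIV - i ` N)"
    using \<open>finite badY\<close> B.finite_empty_part inv.finite_meeting_parts[OF kinj finN]
    by (meson finite_UnI finite_subset)
  have injg: "g ` S = g ` T \<longleftrightarrow> S = T" if "S \<subseteq> A.points" "T \<subseteq> A.points" for S T
    using inj_on_image_eq_iff[OF inj] that by blast
  have "inj_on i N"
  proof (rule inj_onI)
    fix n n' assume n: "n \<in> N" "n' \<in> N" "i n = i n'"
    then have "A.part n = A.part n'" using i(1) injg[OF component_subset component_subset] by metis
    then show "n = n'" using n(1) by (auto simp: N_def mem_component)
  qed
  then have bij_i: "bij_betw i N (i ` N)" by (simp add: bij_betw_def)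
  have "card (pverts (G n)) = card (pverts (H (i n)))" if "n \<in> N" for n
    using card_image[OF inj_on_subset[OF inj component_subset[of _ n]]] i(1)[OF that]
    by simp
  moreover have "(\<Sum>n\<in>UNIV - N. card (pverts (G n))) = (\<Sum>n\<in>UNIV - i ` N. card (pverts (H n)))"
  proof -
    \<comment> \<open>As a bijection, \<open>g\<close> also carries the complement of the matched
      components onto the complement of their images.\<close>
    have "g ` (A.points - (\<Union>n\<in>N. A.part n)) = B.points - (\<Union>n\<in>N. g ` A.part n)"
      using inj_on_image_set_diff[OF inj, of A.points "\<Union>n\<in>N. A.part n"] im
      by (simp add: component_subset UN_least image_UN)
    also have "(\<Union>n\<in>N. g ` A.part n) = (\<Union>m\<in>i ` N. B.part m)" using i(1) by simp
    finally have "g ` (\<Union>n\<in>UNIV - N. A.part n) = (\<Union>m\<in>UNIV - i ` N. B.part m)"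
      by (simp only: Union_components_Diff)
    moreover have "inj_on g (\<Union>n\<in>UNIV - N. A.part n)"
      by (rule inj_on_subset[OF inj]) (auto simp: mem_component)
    ultimately have "card (\<Union>n\<in>UNIV - N. A.part n) = card (\<Union>m\<in>UNIV - i ` N. B.part m)"
      by (metis card_image)
    then show ?thesis by (simp only: card_Union_components finN finM finite_pverts)
  qed
  ultimately show ?thesis using finN finM bij_i i(2) unfolding matched_def by blast
qed

text \<open>For \<open>y\<close> in \<open>B.part (i n)\<close> the candidate is \<open>k y\<close>,
  with \<open>k\<close> a coarse inverse. It lies in \<open>A.part n\<close> unless
  \<open>B.part (i n)\<close> is crowded or is hit by one of the finitely many points in unmatched
  components.\<close>

lemma finite_not_coarsely_dense:
  assumes f: "coarse_equivalence A.points dX B.points dY f" and fin: "finite (UNIV - N)"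
    and i: "inj_on i N" "\<And>n. n \<in> N \<Longrightarrow> f ` A.part n \<subseteq> B.part (i n)"
  obtains c where "c \<ge> 0" "finite {n\<in>N. \<not> (\<forall>y\<in>B.part (i n). \<exists>x\<in>A.part n. dY (f x) y \<le> c)}"
proof -
  obtain k where im: "f ` A.points \<subseteq> B.points" "k ` B.points \<subseteq> A.points"
    and "close_maps B.points dY (f \<circ> k) id"
    using f by (auto simp: coarse_equivalence_def coarse_map_def)
  then obtain c where c: "c \<ge> 0" "\<forall>y\<in>B.points. dY (f (k y)) y \<le> c"
    unfolding close_maps_iff by auto
  define F where "F = B.crowded c \<union> (\<lambda>x. fst (f x)) ` (\<Union>n\<in>UNIV - N. A.part n)"
  have "finite F" using B.finite_crowded A.finite_part fin by (simp add: F_def)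
  then have "finite (i -` F \<inter> N)" using i(1) by (rule finite_vimage_IntI)
  moreover have "\<exists>x\<in>A.part n. dY (f x) y \<le> c" if n: "n \<in> N" "i n \<notin> F" and y: "y \<in> B.part (i n)" for n y
  proof -
    have pts: "y \<in> B.points" "k y \<in> A.points" "f (k y) \<in> B.points" "fst y = i n"
      using y im by (auto simp: mem_component)
    then have near: "dY (f (k y)) y \<le> c" using c by blast
    then have eq: "fst (f (k y)) = i n"
      using B.crowdedI(2)[of "f (k y)" y c] pts n by (auto simp: F_def)
    have "fst (k y) \<in> N"
    proof (rule ccontr)
      assume "fst (k y) \<notin> N"
      then have "k y \<in> (\<Union>n\<in>UNIV - N. A.part n)" using in_component_fst[OF pts(2)] by blast
      then have "fst (f (k y)) \<in> F" unfolding F_def by blast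
      then show False using n eq by simp
    qed
    then have "i (fst (k y)) = i n"
      using image_component_subsetD(3)[OF i(2) in_component_fst[OF pts(2)]] eq by simp
    then have "fst (k y) = n" using i(1) \<open>fst (k y) \<in> N\<close> n by (auto dest: inj_onD)
    then show ?thesis using near in_component_fst[OF pts(2)] by blast
  qed
  then have "{n\<in>N. \<not> (\<forall>y\<in>B.part (i n). \<exists>x\<in>A.part n. dY (f x) y \<le> c)} \<subseteq> i -` F \<inter> N" by blast
  ultimately show ?thesis by (intro that[OF c(1)]) (rule finite_subset)
qed

text \<open>Expander matching with constants independent of the components: \<open>R\<close> is
  fixed before \<open>n\<close> and \<open>m\<close>.\<close>

lemma uniformly_close_bijections:
  assumes f: "coarse_equivalence A.points dX B.points dY f" and c: "c \<ge> 0"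
  obtains R where "\<And>n m. \<lbrakk>card (pverts (G n)) = card (pverts (H m)); f ` A.part n \<subseteq> B.part m;
      \<forall>y\<in>B.part m. \<exists>x\<in>A.part n. dY (f x) y \<le> c\<rbrakk>
    \<Longrightarrow> \<exists>g. bij_betw g (A.part n) (B.part m) \<and> (\<forall>x\<in>A.part n. dY (f x) (g x) \<le> R)"
proof -
  obtain k where im: "f ` A.points \<subseteq> B.points" "k ` B.points \<subseteq> A.points"
    and "close_maps A.points dX (k \<circ> f) id"
    using f by (auto simp: coarse_equivalence_def coarse_map_def)
  then obtain a where a: "\<forall>x\<in>A.points. dX (k (f x)) x \<le> a"
    unfolding close_maps_iff by auto
  obtain K1 where K1: "\<forall>n. \<forall>x\<in>A.part n. card {y \<in> A.part n. dX x y \<le> 2 * a} \<le> K1"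
    using A.card_balls_bounded by blast
  obtain K2 where K2: "\<forall>n. \<forall>x\<in>B.part n. card {y \<in> B.part n. dY x y \<le> c} \<le> K2"
    using B.card_balls_bounded by blast
  define K where "K = max K1 K2"
  obtain h where h: "h > 0" "\<And>n D. D \<subseteq> B.part n \<Longrightarrow>
      (1 + h * (1 - real (card D) / real (card (B.part n)))) * real (card D)
        \<le> real (card (thicken (B.part n) dY 1 D))"
    by (rule B.thicken_expands) blast
  \<comment> \<open>The number of growth steps that outweighs the bound \<open>K\<close> on fibres
    and balls.\<close>
  obtain p where p: "real K < (1 + h / 2) ^ p"
    using real_arch_pow[of "1 + h / 2"] h(1) by auto
  have fibres: "card {x \<in> A.part n. f x = y} \<le> K" for n y
  proof (cases "{x \<in> A.part n. f x = y} = {}")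
    case False
    then obtain x where x: "x \<in> A.part n" "f x = y" by blast
    \<comment> \<open>Two points of the fibre over \<open>y\<close> are both within \<open>a\<close>
      of \<open>k y\<close>, so fibres lie in balls of radius \<open>2 * a\<close>.\<close>
    have "dX x z \<le> 2 * a" if z: "z \<in> A.part n" "f z = y" for z
    proof -
      have "x \<in> A.points" "z \<in> A.points" using x z by (auto simp: mem_component)
      moreover have "k y \<in> A.points" using im calculation x by blast
      moreover have "dX (k y) x \<le> a" "dX (k y) z \<le> a"
        using bspec[OF a \<open>x \<in> A.points\<close>] bspec[OF a \<open>z \<in> A.points\<close>] x(2) z(2) by simp_all
      ultimately show ?thesis
        using A.triangle''[of x "k y" z] by linarith
    qed
    then have "{x \<in> A.part n. f x = y} \<subseteq> {z \<in> A.part n. dX x z \<le> 2 * a}" by blast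
    then have "card {x \<in> A.part n. f x = y} \<le> card {z \<in> A.part n. dX x z \<le> 2 * a}"
      using A.finite_part by (intro card_mono) auto
    also have "\<dots> \<le> K1" using K1 x by blast
    finally show ?thesis by (simp add: K_def)
  next
    case True
    then show ?thesis by (simp only: card.empty le0)
  qed
  show ?thesis
  proof (rule that)
    fix n m
    assume *: "card (pverts (G n)) = card (pverts (H m))" "f ` A.part n \<subseteq> B.part m"
      "\<forall>y\<in>B.part m. \<exists>x\<in>A.part n. dY (f x) y \<le> c"
    show "\<exists>g. bij_betw g (A.part n) (B.part m) \<and>
        (\<forall>x\<in>A.part n. dY (f x) (g x) \<le> 2 * real p + c)"
    proof (rule Metric_space.expander_matching[OF B.part_metric_space B.finite_part h(1)])
      show "card {y \<in> B.part m. dY x y \<le> c} \<le> K" if "x \<in> B.part m" for x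
        using K2 that by (simp add: K_def le_max_iff_disj)
    qed (use h(2) A.finite_part * fibres c p in auto)
  qed
qed

text \<open>Bijections are glued from uniformly close ones on dense components, arbitrary ones on
  the finitely many sparse components, and one on the unmatched points.\<close>

lemma bijective_if_matched:
  assumes f: "coarse_equivalence A.points dX B.points dY f" and "matched f N M i"
  shows "\<exists>g. bijective_coarse_equivalence A.points dX B.points dY g \<and> close_maps A.points dY f g"
proof -
  have fin: "finite (UNIV - N)" "finite (UNIV - M)" and bij: "bij_betw i N M"
    and sum: "(\<Sum>n\<in>UNIV - N. card (pverts (G n))) = (\<Sum>n\<in>UNIV - M. card (pverts (H n)))"
    and card: "\<And>n. n \<in> N \<Longrightarrow> card (pverts (G n)) = card (pverts (H (i n)))"
    and fi: "\<And>n. n \<in> N \<Longrightarrow> f ` A.part n \<subseteq> B.part (i n)"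
    using assms(2) by (auto simp: matched_def)
  have inj: "inj_on i N" and M: "M = i ` N" using bij by (auto simp: bij_betw_def)
  obtain c where c: "c \<ge> 0"
    and finc: "finite {n\<in>N. \<not> (\<forall>y\<in>B.part (i n). \<exists>x\<in>A.part n. dY (f x) y \<le> c)}"
    using finite_not_coarsely_dense[OF f fin(1) inj fi] by blast
  define sparse where "sparse = {n\<in>N. \<not> (\<forall>y\<in>B.part (i n). \<exists>x\<in>A.part n. dY (f x) y \<le> c)}"
  obtain R where R: "\<And>n m. \<lbrakk>card (pverts (G n)) = card (pverts (H m)); f ` A.part n \<subseteq> B.part m;
      \<forall>y\<in>B.part m. \<exists>x\<in>A.part n. dY (f x) y \<le> c\<rbrakk>
    \<Longrightarrow> \<exists>g. bij_betw g (A.part n) (B.part m) \<and> (\<forall>x\<in>A.part n. dY (f x) (g x) \<le> R)"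
    using uniformly_close_bijections[OF f c] by blast
  have "\<exists>g. bij_betw g (A.part n) (B.part (i n)) \<and>
      (n \<notin> sparse \<longrightarrow> (\<forall>x\<in>A.part n. dY (f x) (g x) \<le> R))" if n: "n \<in> N" for n
  proof (cases "n \<in> sparse")
    case True
    have "\<exists>g. bij_betw g (A.part n) (B.part (i n))"
      using card[OF n] A.finite_part B.finite_part by (intro finite_same_card_bij) auto
    with True show ?thesis by blast
  next
    case False
    then have "\<forall>y\<in>B.part (i n). \<exists>x\<in>A.part n. dY (f x) y \<le> c" using n by (simp add: sparse_def)
    from R[OF card[OF n] fi[OF n] this] show ?thesis by blast
  qed
  then have "\<forall>n\<in>N. \<exists>g. bij_betw g (A.part n) (B.part (i n)) \<and>
      (n \<notin> sparse \<longrightarrow> (\<forall>x\<in>A.part n. dY (f x) (g x) \<le> R))" ..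
  from bchoice[OF this] obtain \<phi> where \<phi>: "\<And>n. n \<in> N \<Longrightarrow> bij_betw (\<phi> n) (A.part n) (B.part (i n))"
    "\<And>n x. \<lbrakk>n \<in> N; n \<notin> sparse; x \<in> A.part n\<rbrakk> \<Longrightarrow> dY (f x) (\<phi> n x) \<le> R"
    by blast
  let ?XN = "\<Union>n\<in>N. A.part n" and ?YM = "\<Union>m\<in>M. B.part m"
  let ?XF = "\<Union>n\<in>UNIV - N. A.part n" and ?YF = "\<Union>m\<in>UNIV - M. B.part m"
  \<comment> \<open>The equality of the two sums says that the unmatched points are equinumerous;
    they need not correspond component by component.\<close>
  have "\<exists>\<psi>. bij_betw \<psi> ?XF ?YF"
    using fin sum A.finite_part B.finite_part
    by (intro finite_same_card_bij) (simp_all add: card_Union_components finite_pverts)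
  then obtain \<psi> where \<psi>: "bij_betw \<psi> ?XF ?YF" by blast
  define g where "g x = (if fst x \<in> N then \<phi> (fst x) x else \<psi> x)" for x
  have "bij_betw g ?XN ?YM"
  proof -
    have im: "g ` A.part n = B.part (i n)" if "n \<in> N" for n
    proof -
      have "g ` A.part n = \<phi> n ` A.part n"
        using that by (intro image_cong) (auto simp: g_def mem_component)
      then show ?thesis using \<phi>(1)[OF that] by (simp add: bij_betw_def)
    qed
    have "inj_on g ?XN"
    proof (rule inj_onI)
      fix x y assume xy: "x \<in> ?XN" "y \<in> ?XN" "g x = g y"
      then have N: "fst x \<in> N" "fst y \<in> N" "x \<in> A.part (fst x)" "y \<in> A.part (fst y)"
        by (auto simp: mem_component)
      then have "g x \<in> B.part (i (fst x))" "g y \<in> B.part (i (fst y))" using im by blast+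
      then have "i (fst x) = i (fst y)" using xy(3) by (simp add: mem_component)
      then have "fst x = fst y" using inj N by (auto dest: inj_onD)
      then show "x = y"
        using N xy(3) \<phi>(1)[OF N(1)] by (auto simp: g_def bij_betw_def dest: inj_onD)
    qed
    moreover have "g ` ?XN = ?YM" using im by (simp add: image_UN M)
    ultimately show ?thesis by (simp add: bij_betw_def)
  qed
  moreover have "bij_betw g ?XF ?YF"
    using \<psi> by (rule bij_betw_cong[THEN iffD1, rotated]) (auto simp: g_def mem_component)
  moreover have "?YM \<inter> ?YF = {}" by (auto simp: mem_component)
  ultimately have "bij_betw g (?XN \<union> ?XF) (?YM \<union> ?YF)" by (rule bij_betw_combine)
  moreover have "?XN \<union> ?XF = A.points" "?YM \<union> ?YF = B.points" by (auto simp: mem_component)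
  ultimately have bijg: "bij_betw g A.points B.points" by simp
  have "close_maps A.points dY f g"
  proof -
    let ?E = "\<Union>n\<in>(UNIV - N) \<union> sparse. A.part n"
    have "finite ?E" using fin finc A.finite_part unfolding sparse_def by (intro finite_UN_I finite_UnI)
    \<comment> \<open>Off the finite set \<open>?E\<close> the bound is \<open>R\<close>; on it a
      maximum suffices. Inserting 0 keeps \<open>Max\<close> meaningful when \<open>?E\<close> is
      empty.\<close>
    define R' where "R' = max (max R 0) (Max (insert 0 ((\<lambda>x. dY (f x) (g x)) ` ?E)))"
    have "dY (f x) (g x) \<le> R'" if x: "x \<in> A.points" for x
    proof (cases "x \<in> ?E")
      case True
      then have "dY (f x) (g x) \<le> Max (insert 0 ((\<lambda>x. dY (f x) (g x)) ` ?E))"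
        using \<open>finite ?E\<close> by (intro Max_ge) blast+
      then show ?thesis by (simp add: R'_def)
    next
      case False
      then have "fst x \<in> N" "fst x \<notin> sparse" using in_component_fst[OF x] by blast+
      then have "dY (f x) (g x) \<le> R"
        using \<phi>(2) in_component_fst[OF x] by (simp add: g_def)
      then show ?thesis by (simp add: R'_def)
    qed
    then show ?thesis unfolding close_maps_iff by (intro exI[of _ R']) (auto simp: R'_def)
  qed
  \<comment> \<open>Coarseness of \<open>g\<close> and of its inverse need no separate proof: being
    a coarse equivalence passes from \<open>f\<close> to close maps.\<close>
  moreover from this have "coarse_equivalence A.points dX B.points dY g"
    using bijg by (intro coarse_equivalence_close[OF A.Metric_space_axioms B.Metric_space_axioms f])
      (simp_all add: bij_betw_def)
  ultimately show ?thesis using bijg by (auto simp: bijective_coarse_equivalence_def)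
qed

end

theorem theorem1p2:
  fixes G :: "nat \<Rightarrow> 'a pair_pre_digraph" and H :: "nat \<Rightarrow> 'b pair_pre_digraph"
    and dX :: "nat \<times> 'a \<Rightarrow> nat \<times> 'a \<Rightarrow> real" and dY :: "nat \<times> 'b \<Rightarrow> nat \<times> 'b \<Rightarrow> real"
    and f :: "nat \<times> 'a \<Rightarrow> nat \<times> 'b"
  defines "X \<equiv> disjoint_union (\<lambda>n. pverts (G n))"
    and "Y \<equiv> disjoint_union (\<lambda>n. pverts (H n))"
  assumes "coarse_disjoint_union_of_expanders G dX"
    and "coarse_disjoint_union_of_expanders H dY"
    and "coarse_equivalence X dX Y dY f"
  shows "(\<exists>g. bijective_coarse_equivalence X dX Y dY g \<and> close_maps X dY f g) \<longleftrightarrow>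
    (\<exists>(N::nat set) (M::nat set) (i::nat \<Rightarrow> nat).
       finite (UNIV - N) \<and> finite (UNIV - M) \<and> bij_betw i N M \<and>
       (\<Sum>n\<in>UNIV - N. card (pverts (G n))) = (\<Sum>n\<in>UNIV - M. card (pverts (H n))) \<and>
       (\<forall>n\<in>N. card (pverts (G n)) = card (pverts (H (i n))) \<and>
          f ` component (\<lambda>n. pverts (G n)) n \<subseteq> component (\<lambda>n. pverts (H n)) (i n)))"
proof -
  interpret expander_union_pair G dX H dY
    using assms(3,4) by (simp add: expander_union_pair_def expander_union_def)
  have f: "coarse_equivalence A.points dX B.points dY f" using assms(5) by (simp add: X_def Y_def)
  then have "f ` A.points \<subseteq> B.points" by (simp add: coarse_equivalence_def coarse_map_def)
  with f have "(\<exists>g. bijective_coarse_equivalence X dX Y dY g \<and> close_maps X dY f g) \<longleftrightarrow>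
      (\<exists>N M i. matched f N M i)"
    unfolding X_def Y_def using matched_if_bijective bijective_if_matched by blast
  then show ?thesis unfolding matched_def .
qed

end
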